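(* Suppose $\alpha,\beta\in(0,1)$ are fixed and satisfy $\alpha+\beta<1$. Then there exists a constant $c>0$ independent of $n$ such that, for $n$ large enough, the minimax separation rate for testing independence, $$\rho^*(\alpha,\beta)=\inf_{\psi_\alpha\in\Psi(\alpha)}\rho(\psi_\alpha,\beta),$$ satisfies $\rho^*(\alpha,\beta)\ge c\,n^{-1/2}$.
   Context: $\mathcal H$ is a real separable infinite-dimensional Hilbert space with inner product $\langle\cdot,\cdot\rangle$; $\mathcal V$ is the set of Borel probability measures $\nu$ on $\mathcal H$ that are symmetric ($\nu(B)=\nu(-B)$ for all Borel $B$) with $\operatorname{supp}(\nu)=\mathcal H$. The data are i.i.d. copies $(X_1,Y_1),\dots,(X_n,Y_n)$ of an $\mathcal H^2$-valued random variable $(X,Y)$ with distribution $\mathbb P^{X,Y}$ and marginals $\mathbb P^X,\mathbb P^Y$. One tests $H_0:\mathbb P^{X,Y}=\mathbb P^X\otimes\mathbb P^Y$ against $H_1:\mathbb P^{X,Y}\ne\mathbb P^X\otimes\mathbb P^Y$. $\Psi$ is the set of all non-randomized tests $\psi$ ($\{0,1\}$-valued measurable functions of the data; $1$ means rejection), and $\Psi(\alpha)$ is the set of $\psi\in\Psi$ with $\sup\mathrm P(\psi=1)\le\alpha$, the supremum being over all $\mathbb P^{X,Y}$ satisfying $H_0$. With $\varphi_X(w)=\mathbb E e^{\mathrm i\langle X,w\rangle}$, $\varphi_Y(w)=\mathbb E e^{\mathrm i\langle Y,w\rangle}$, $\varphi_{X,Y}(w_1,w_2)=\mathbb E e^{\mathrm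 i\langle X,w_1\rangle+\mathrm i\langle Y,w_2\rangle}$, let $$\mathcal F_\nu(\rho)=\Big\{\mathbb P^{X,Y}:\int_{\mathcal H^2}|\varphi_{X,Y}(w_1,w_2)-\varphi_X(w_1)\varphi_Y(w_2)|^2\nu(\mathrm dw_1)\nu(\mathrm dw_2)\ge\rho\Big\},$$ and define the uniform separation rate $\rho(\psi,\beta)=\inf\{\rho>0:\sup_{\nu\in\mathcal V}\sup_{\mathbb P^{X,Y}\in\mathcal F_\nu(\rho)}\mathrm P(\psi=0)\le\beta\}$. *)

theory Defs
  imports "HOL-Probability.Probability"
begin

text \<open>
  The Hilbert space is a type \<^typ>\<open>'a\<close> of class \<^class>\<open>real_inner\<close>; completeness, separability and
  infinite dimension are imposed in the theorem. Distributions of random elements are Borel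
  probability measures.
\<close>

definition borel_laws :: "'b::topological_space measure set" where
  "borel_laws = {P. prob_space P \<and> sets P = sets borel}"

definition measure_supp :: "'b::topological_space measure \<Rightarrow> 'b set" where
  "measure_supp \<nu> = {x. \<forall>U. open U \<and> x \<in> U \<longrightarrow> emeasure \<nu> U > 0}"

definition symmetric_measure :: "'b::real_normed_vector measure \<Rightarrow> bool" where
  "symmetric_measure \<nu> \<longleftrightarrow> (\<forall>B\<in>sets borel. emeasure \<nu> B = emeasure \<nu> (uminus ` B))"

definition weight_measures :: "'a::real_inner measure set" where
  "weight_measures = {\<nu>\<in>borel_laws. symmetric_measure \<nu> \<and> measure_supp \<nu> = UNIV}"

definition null_laws :: "('a::real_inner \<times> 'a) measure set" where
  "null_laws = {P\<in>borel_laws. P = distr P borel fst \<Otimes>\<^sub>M distr P borel snd}"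

definition charfun :: "'a::real_inner measure \<Rightarrow> 'a \<Rightarrow> complex" where
  "charfun P w = (CLINT x|P. iexp (x \<bullet> w))"

definition joint_charfun :: "('a::real_inner \<times> 'a) measure \<Rightarrow> 'a \<Rightarrow> 'a \<Rightarrow> complex" where
  "joint_charfun P w1 w2 = (CLINT z|P. exp (\<i> * of_real (fst z \<bullet> w1) + \<i> * of_real (snd z \<bullet> w2)))"

text \<open>The weighted squared distance from independence. The integrand is continuous and bounded,
  so the Bochner integral is a genuine one when \<^term>\<open>\<nu>\<close> and \<^term>\<open>P\<close> are Borel laws
  on separable spaces.\<close>

definition dependence :: "'a::real_inner measure \<Rightarrow> ('a \<times> 'a) measure \<Rightarrow> real" where
  "dependence \<nu> P =
     (LINT w|(\<nu> \<Otimes>\<^sub>M \<nu>). (cmod (joint_charfun P (fst w) (snd w)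
        - charfun (distr P borel fst) (fst w) * charfun (distr P borel snd) (snd w)))\<^sup>2)"

definition alternatives :: "'a::real_inner measure \<Rightarrow> real \<Rightarrow> ('a \<times> 'a) measure set" where
  "alternatives \<nu> \<rho> = {P\<in>borel_laws. dependence \<nu> P \<ge> \<rho>}"

text \<open>The sample \<open>(X\<^sub>1,Y\<^sub>1),\<dots>,(X\<^sub>n,Y\<^sub>n)\<close> is indexed by \<open>{..<n}\<close>; its law is the \<open>n\<close>-fold product.\<close>

definition sample_law :: "nat \<Rightarrow> 'b measure \<Rightarrow> (nat \<Rightarrow> 'b) measure" where
  "sample_law n P = (\<Pi>\<^sub>M i\<in>{..<n}. P)"

type_synonym 'a test = "(nat \<Rightarrow> 'a \<times> 'a) \<Rightarrow> nat"

definition tests :: "nat \<Rightarrow> 'a::real_inner test set" where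
  "tests n = measurable (\<Pi>\<^sub>M i\<in>{..<n}. borel) (count_space {0, 1})"

definition test_prob :: "nat \<Rightarrow> ('a::real_inner \<times> 'a) measure \<Rightarrow> 'a test \<Rightarrow> nat \<Rightarrow> ennreal" where
  "test_prob n P \<psi> d = emeasure (sample_law n P) {\<omega>\<in>space (sample_law n P). \<psi> \<omega> = d}"

definition level_tests :: "nat \<Rightarrow> real \<Rightarrow> 'a::real_inner test set" where
  "level_tests n \<alpha> = {\<psi>\<in>tests n. (SUP P\<in>null_laws. test_prob n P \<psi> 1) \<le> ennreal \<alpha>}"

text \<open>Suprema and infima are taken in \<^typ>\<open>ennreal\<close>, so that a supremum over an empty class of
  alternatives is \<open>0\<close>.\<close>

definition separation_rate :: "nat \<Rightarrow> 'a::real_inner test \<Rightarrow> real \<Rightarrow> ennreal" where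
  "separation_rate n \<psi> \<beta> =
     (INF \<rho>\<in>{\<rho>. \<rho> > 0 \<and> (SUP \<nu>\<in>weight_measures. SUP P\<in>alternatives \<nu> \<rho>. test_prob n P \<psi> 0) \<le> ennreal \<beta>}.
        ennreal \<rho>)"

definition minimax_rate :: "'a::real_inner itself \<Rightarrow> nat \<Rightarrow> real \<Rightarrow> real \<Rightarrow> ennreal" where
  "minimax_rate H n \<alpha> \<beta> = (INF \<psi>\<in>(level_tests n \<alpha> :: 'a test set). separation_rate n \<psi> \<beta>)"

end

theory Submission
  imports Defs
begin

text \<open>
  In infinite dimension a fixed sample size cannot detect dependence that is spread over sufficiently
  many directions, so the minimax rate is at least the constant \<open>1 / 4\<close> for every sample size \<open>n\<close>,
  and a fortiori at least \<open>1 / (4 \<surd>n)\<close> for \<open>n \<ge> 1\<close>.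
  
  Take orthonormal vectors \<open>x\<^sub>0, \<dots>, x\<^sub>m\<close> and write \<open>e = x\<^sub>m\<close>. Let \<open>i < m\<close> and the bits \<open>b\<close>, \<open>c\<close> be uniform and
  independent. Under the null law \<open>X = x\<^sub>i + b e\<close> and \<open>Y = c e\<close>. Under the alternative belonging to a
  code \<open>g : {0, \<dots>, m - 1} \<rightarrow> {0, 1}\<close>, \<open>X\<close> is the same but \<open>Y = (b xor g(i)) e\<close>: the response is a
  function of the covariate, masked by the secret bit \<open>g(i)\<close> of the label \<open>i\<close>.
  
  Each alternative is far from independence for a weight adapted to it. With
  \<open>w = \<pi> (\<Sum>\<^sub>i g(i) x\<^sub>i + e)\<close>, both \<open>exp(\<i> (X \<bullet> w))\<close> and \<open>exp(\<i> (Y \<bullet> w))\<close> equal the same unbiased random sign, so the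
  difference of characteristic functions at \<open>(\<plusminus>w, \<plusminus>w)\<close> is \<open>1\<close>; a weight with mass \<open>1 / 2\<close> on \<open>{w, -w}\<close>
  makes the dependence at least \<open>1 / 4\<close> (\<open>code_law_in_alternatives\<close>).
  
  No test recognises all codes at once. As long as the \<open>n\<close> observed labels are distinct, the bits that
  mask the responses are independent coin tosses when \<open>g\<close> is uniformly random, so the average over all
  codes of the alternative sampling laws agrees with the null sampling law on this event
  (\<open>averaging_over_codes\<close>). The labels are distinct with probability at least \<open>(1 - n / m)\<^sup>n \<ge> 1 - n\<^sup>2 / m\<close>.
  Hence a test of level \<open>\<alpha>\<close> that accepts each of these alternatives with probability at most \<open>\<beta>\<close> has
  \<open>\<alpha> + \<beta> \<ge> 1 - n\<^sup>2 / m\<close> (\<open>error_sum_lower_bound\<close>). Infinite dimension lets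
  \<open>m\<close> be as large as desired for given \<open>n\<close>, which contradicts \<open>\<alpha> + \<beta> < 1\<close>.
\<close>

section \<open>Orthonormal families of any finite length\<close>

lemma orthonormal_sequence:
  assumes "\<nexists>B :: 'a::real_inner set. finite B \<and> span B = UNIV"
  shows "\<exists>x :: nat \<Rightarrow> 'a. \<forall>i<N. \<forall>j<N. x i \<bullet> x j = of_bool (i = j)"
proof (induction N)
  case 0
  then show ?case by simp
next
  case (Suc N)
  then obtain x :: "nat \<Rightarrow> 'a" where x: "\<And>i j. i < N \<Longrightarrow> j < N \<Longrightarrow> x i \<bullet> x j = of_bool (i = j)"
    by blast
  have "span (x ` {..<N}) \<noteq> UNIV"
    using assms by blast
  then obtain a where a: "a \<notin> span (x ` {..<N})"
    by blast
  \<comment> \<open>one step of Gram--Schmidt: \<open>sgn b\<close> is the next vector\<close>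
  define b where "b = a - (\<Sum>i<N. (a \<bullet> x i) *\<^sub>R x i)"
  have "(\<Sum>i<N. (a \<bullet> x i) *\<^sub>R x i) \<in> span (x ` {..<N})"
    by (intro span_sum span_scale span_base) auto
  with a have "b \<noteq> 0"
    by (auto simp: b_def)
  have bx: "b \<bullet> x j = 0" if "j < N" for j
    using that by (simp add: b_def inner_diff_left inner_sum_left x)
  have "sgn b \<bullet> sgn b = 1"
    using \<open>b \<noteq> 0\<close> by (simp add: dot_square_norm norm_sgn)
  moreover have "sgn b \<bullet> x j = 0" "x j \<bullet> sgn b = 0" if "j < N" for j
    using bx[OF that] by (simp_all add: sgn_div_norm inner_commute)
  ultimately show ?case
    by (intro exI[of _ "x(N := sgn b)"]) (auto simp: x less_Suc_eq)
qed

section \<open>Discrete laws and the error probabilities of tests\<close>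

lemma borel_laws_distr_pmf: "distr (measure_pmf p) borel h \<in> borel_laws"
  by (simp add: borel_laws_def measure_pmf.prob_space_distr)

text \<open>
  A pair of functions of independent discrete variables has a product law. Countability of the index
  types makes every rectangle of preimages countable, as the product rule for
  \<^const>\<open>pair_pmf\<close> requires.
\<close>

lemma distr_pair_pmf_null_law:
  fixes f :: "'i::countable \<Rightarrow> 'a::{real_inner, second_countable_topology}" and g :: "'j::countable \<Rightarrow> 'a"
  shows "distr (measure_pmf (pair_pmf p q)) borel (map_prod f g) \<in> null_laws"
proof -
  let ?P = "distr (measure_pmf (pair_pmf p q)) borel (map_prod f g)"
  let ?A = "distr (measure_pmf p) borel f" and ?B = "distr (measure_pmf q) borel g"
  have fst_meas: "fst \<in> borel_measurable (borel :: ('a \<times> 'a) measure)"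
    and snd_meas: "snd \<in> borel_measurable (borel :: ('a \<times> 'a) measure)"
    by (simp_all add: borel_prod[symmetric])
  have "distr ?P borel fst = distr (measure_pmf (map_pmf fst (pair_pmf p q))) borel f"
    by (simp add: distr_distr fst_meas map_pmf_rep_eq comp_def del: map_fst_pair_pmf)
  hence fst: "distr ?P borel fst = ?A"
    by (simp add: map_fst_pair_pmf)
  have "distr ?P borel snd = distr (measure_pmf (map_pmf snd (pair_pmf p q))) borel g"
    by (simp add: distr_distr snd_meas map_pmf_rep_eq comp_def del: map_snd_pair_pmf)
  hence snd: "distr ?P borel snd = ?B"
    by (simp add: map_snd_pair_pmf)
  have "?A \<Otimes>\<^sub>M ?B = ?P"
  proof (rule pair_measure_eqI)
    show "sigma_finite_measure ?A" "sigma_finite_measure ?B"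
      by (auto intro!: prob_space_imp_sigma_finite measure_pmf.prob_space_distr)
    show "sets (?A \<Otimes>\<^sub>M ?B) = sets ?P"
      by (simp add: borel_prod[symmetric] cong: sets_pair_measure_cong)
  next
    fix A B assume "A \<in> sets ?A" "B \<in> sets ?B"
    hence AB: "A \<in> sets borel" "B \<in> sets borel" by auto
    hence "A \<times> B \<in> sets borel"
      by (simp add: borel_prod[symmetric])
    moreover have "map_prod f g -` (A \<times> B) = (f -` A) \<times> (g -` B)"
      by auto
    ultimately show "emeasure ?A A * emeasure ?B B = emeasure ?P (A \<times> B)"
      using AB by (simp add: emeasure_distr measure_pmf.emeasure_eq_measure
          measure_pmf_prob_product ennreal_mult)
  qed
  with fst snd show ?thesis
    by (simp add: null_laws_def borel_laws_distr_pmf)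
qed

lemma pair_pmf_of_set:
  assumes "finite A" "A \<noteq> {}" "finite B" "B \<noteq> {}"
  shows "pair_pmf (pmf_of_set A) (pmf_of_set B) = pmf_of_set (A \<times> B)"
proof (rule pmf_eqI)
  fix c
  have "pmf (pmf_of_set (A \<times> B)) c = indicator (A \<times> B) c / real (card (A \<times> B))"
    using assms by (intro pmf_of_set) auto
  thus "pmf (pair_pmf (pmf_of_set A) (pmf_of_set B)) c = pmf (pmf_of_set (A \<times> B)) c"
    using assms by (cases c) (simp add: pmf_pair card_cartesian_product indicator_times)
qed

text \<open>
  For observations that are functions of uniform draws from a finite set, the sample is a function of
  a uniform draw from the finite set of \<open>n\<close>-tuples. This turns error probabilities into cardinalities,
  and the comparison of sampling laws into counting.
\<close>

lemma test_prob_pmf: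
  fixes h :: "'i \<Rightarrow> 'a::{real_inner, second_countable_topology} \<times> 'a"
  assumes \<psi>: "\<psi> \<in> tests n" and S: "finite S" "S \<noteq> {}"
  shows "test_prob n (distr (measure_pmf (pmf_of_set S)) borel h) \<psi> d =
    ennreal (real (card {v \<in> PiE {..<n} (\<lambda>_. S). \<psi> (\<lambda>k\<in>{..<n}. h (v k)) = d}) / real (card S) ^ n)"
proof -
  let ?M = "distr (measure_pmf (pmf_of_set S)) borel h"
  let ?B = "\<Pi>\<^sub>M k\<in>{..<n}. (borel :: ('a \<times> 'a) measure)"
  let ?Z = "PiE {..<n} (\<lambda>_. S)"
  define H where "H v = (\<lambda>k\<in>{..<n}. h (v k))" for v
  let ?q = "Pi_pmf {..<n} undefined (\<lambda>_. pmf_of_set S)"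
  interpret product_sigma_finite "\<lambda>_::nat. ?M"
    by (rule product_sigma_finite.intro, rule prob_space_imp_sigma_finite,
        rule measure_pmf.prob_space_distr) simp
  have H_meas: "H \<in> measure_pmf ?q \<rightarrow>\<^sub>M ?B"
    by (rule measurableI) (auto simp: H_def space_PiM)
  have law: "distr (measure_pmf ?q) ?B H = sample_law n ?M"
    unfolding sample_law_def
  proof (rule PiM_eqI)
    show "sets (distr (measure_pmf ?q) ?B H) = sets (\<Pi>\<^sub>M i\<in>{..<n}. ?M)"
      unfolding sets_distr by (rule sets_PiM_cong) simp_all
    fix A :: "nat \<Rightarrow> ('a \<times> 'a) set" assume "\<And>k. k \<in> {..<n} \<Longrightarrow> A k \<in> sets ?M"
    hence A: "\<And>k. k < n \<Longrightarrow> A k \<in> sets borel" by simp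
    have "H -` PiE {..<n} A = Pi {..<n} (\<lambda>k. h -` A k)"
      by (auto simp: H_def PiE_iff Pi_iff)
    moreover have "PiE {..<n} A \<in> sets ?B"
      using A by (intro sets_PiM_I_finite) auto
    ultimately show "emeasure (distr (measure_pmf ?q) ?B H) (PiE {..<n} A) = (\<Prod>k\<in>{..<n}. emeasure ?M (A k))"
      using A by (simp add: emeasure_distr[OF H_meas] emeasure_distr measure_pmf.emeasure_eq_measure
          measure_Pi_pmf_Pi prod_ennreal)
  qed auto
  have "\<psi> -` {d} \<inter> space ?B \<in> sets ?B"
  proof (cases "d \<in> {0, 1}")
    case True
    with \<psi> show ?thesis
      unfolding tests_def by (intro measurable_sets[where A = "count_space {0, 1}"]) simp_all
  next
    case False
    have "\<psi> \<omega> \<in> {0, 1}" if "\<omega> \<in> space ?B" for \<omega>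
      using \<psi> that measurable_space[of \<psi> ?B "count_space {0, 1}"] unfolding tests_def by auto
    with False have "\<psi> -` {d} \<inter> space ?B = {}" by blast
    thus ?thesis by simp
  qed
  moreover have "{\<omega> \<in> space (sample_law n ?M). \<psi> \<omega> = d} = \<psi> -` {d} \<inter> space ?B"
    by (auto simp: sample_law_def space_PiM)
  ultimately have "test_prob n ?M \<psi> d = emeasure (measure_pmf ?q) (H -` (\<psi> -` {d} \<inter> space ?B))"
    unfolding test_prob_def by (simp add: emeasure_distr[OF H_meas] flip: law)
  also have "H -` (\<psi> -` {d} \<inter> space ?B) = {v. \<psi> (H v) = d}"
    using measurable_space[OF H_meas] by simp blast
  also have "?q = pmf_of_set ?Z"
  proof -
    have "PiE_dflt {..<n} undefined (\<lambda>_. S) = ?Z"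
      unfolding PiE_dflt_def by (auto simp: PiE_iff extensional_def)
    thus ?thesis
      using S by (simp add: Pi_pmf_of_set)
  qed
  also have "emeasure (measure_pmf (pmf_of_set ?Z)) {v. \<psi> (H v) = d} =
      ennreal (real (card (?Z \<inter> {v. \<psi> (H v) = d})) / real (card ?Z))"
  proof (rule emeasure_pmf_of_set)
    show "?Z \<noteq> {}" using S by (simp add: PiE_eq_empty_iff)
    show "finite ?Z" using S by (intro finite_PiE) simp_all
  qed
  also have "card ?Z = card S ^ n"
    by (simp add: card_PiE)
  also have "?Z \<inter> {v. \<psi> (H v) = d} = {v \<in> ?Z. \<psi> (H v) = d}" by blast
  finally show ?thesis by (simp add: H_def)
qed

section \<open>Weights with large atoms at a chosen frequency\<close>

text \<open>
  The weight is the law of a random sign times either \<open>w\<close> or a random element of a countable dense set,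
  each with probability \<open>1 / 2\<close>: the sign gives symmetry, the dense set gives full support.
\<close>

lemma weight_with_atoms:
  fixes w :: "'a::{real_inner, second_countable_topology}"
  shows "\<exists>\<nu>\<in>weight_measures. measure \<nu> {w, - w} \<ge> 1 / 2"
proof -
  obtain D :: "'a set" where D: "countable D" "\<And>U. open U \<Longrightarrow> U \<noteq> {} \<Longrightarrow> \<exists>d\<in>D. d \<in> U"
    using countable_dense_setE by blast
  have "D \<noteq> {}"
    using D(2)[of UNIV] by auto
  let ?coin = "bernoulli_pmf (1 / 2)"
  define pick :: "bool \<times> nat \<Rightarrow> 'a" where "pick = (\<lambda>(b, k). if b then w else from_nat_into D k)"
  define signed :: "bool \<times> bool \<times> nat \<Rightarrow> 'a" where
    "signed = (\<lambda>(s, t). if s then pick t else - pick t)"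
  define q where "q = pair_pmf ?coin (pair_pmf ?coin (geometric_pmf (1 / 2)))"
  define p where "p = map_pmf signed q"
  have p_flip: "map_pmf uminus p = p"
  proof -
    have "pmf (map_pmf Not ?coin) s = pmf ?coin s" for s
      using pmf_map_inj'[of Not ?coin "\<not> s"] by (cases s) (auto simp: inj_def)
    hence "map_pmf Not ?coin = ?coin"
      by (intro pmf_eqI)
    hence "map_pmf (apfst Not) q = q"
      by (simp add: q_def flip: pair_map_pmf1)
    moreover have "uminus \<circ> signed = signed \<circ> apfst Not"
      by (auto simp: signed_def fun_eq_iff)
    ultimately show ?thesis
      by (metis p_def pmf.map_comp)
  qed
  define \<nu> where "\<nu> = distr (measure_pmf p) borel id"
  have emeasure_\<nu>: "emeasure \<nu> B = emeasure (measure_pmf p) B" if "B \<in> sets borel" for B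
    using that by (simp add: \<nu>_def emeasure_distr)
  have "symmetric_measure \<nu>"
    unfolding symmetric_measure_def
  proof
    fix B :: "'a set" assume B: "B \<in> sets borel"
    have im: "uminus ` B = uminus -` B"
      by force
    have "uminus \<in> borel_measurable (borel :: 'a measure)"
      by measurable
    from measurable_sets[OF this B] have mB: "uminus -` B \<in> sets borel"
      by (simp only: space_borel Int_UNIV_right)
    have "emeasure \<nu> B = emeasure (map_pmf uminus p) B"
      by (simp only: p_flip emeasure_\<nu>[OF B])
    also have "\<dots> = emeasure \<nu> (uminus -` B)"
      by (simp only: emeasure_map_pmf emeasure_\<nu>[OF mB])
    finally show "emeasure \<nu> B = emeasure \<nu> (uminus ` B)"
      by (simp only: im)
  qed
  moreover have "measure_supp \<nu> = UNIV"
  proof -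
    have "emeasure \<nu> U > 0" if U: "open U" "x \<in> U" for x U
    proof -
      obtain d where d: "d \<in> D" "d \<in> U"
        using D(2)[of U] U by auto
      obtain k where k: "from_nat_into D k = d"
        using from_nat_into_surj[OF D(1) d(1)] by blast
      have "signed (True, False, k) = d"
        by (simp add: signed_def pick_def k)
      moreover have "(True, False, k) \<in> set_pmf q"
        by (simp add: q_def set_pmf_geometric set_pmf_bernoulli)
      ultimately have "d \<in> set_pmf p"
        unfolding p_def set_map_pmf by blast
      with d have "measure p U \<noteq> 0"
        by (intro measure_measure_pmf_not_zero) blast
      thus ?thesis
        using U by (simp add: emeasure_\<nu> measure_pmf.emeasure_eq_measure less_le)
    qed
    thus ?thesis by (auto simp: measure_supp_def)
  qed
  moreover have "measure \<nu> {w, -w} \<ge> 1 / 2"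
  proof -
    have "1 / 2 = measure (map_pmf fst (map_pmf snd q)) {True}"
      by (simp add: q_def map_snd_pair_pmf map_fst_pair_pmf measure_pmf_single)
    also have "\<dots> = measure q {t. fst (snd t)}"
      unfolding measure_map_pmf by (rule arg_cong[where f = "measure q"]) auto
    also have "\<dots> \<le> measure q (signed -` {w, - w})"
      by (intro measure_pmf.finite_measure_mono) (auto simp: signed_def pick_def)
    also have "\<dots> = measure \<nu> {w, - w}"
      by (simp only: measure_def emeasure_\<nu>[OF borel_closed[OF finite_imp_closed[of "{w, - w}"]]] p_def emeasure_map_pmf finite.intros)
    finally show ?thesis .
  qed
  ultimately show ?thesis
    by (intro bexI[of _ \<nu>]) (auto simp: weight_measures_def \<nu>_def borel_laws_distr_pmf)
qed

lemma borel_measurable_charfun: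
  fixes P :: "'a::{real_inner, second_countable_topology} measure"
  assumes "P \<in> borel_laws"
  shows "charfun P \<in> borel_measurable borel"
proof -
  interpret prob_space P using assms by (simp add: borel_laws_def)
  have [measurable_cong]: "sets P = sets borel" using assms by (simp add: borel_laws_def)
  show ?thesis unfolding charfun_def by measurable
qed

lemma borel_measurable_joint_charfun:
  fixes P :: "('a::{real_inner, second_countable_topology} \<times> 'a) measure"
  assumes "P \<in> borel_laws"
  shows "(\<lambda>w. joint_charfun P (fst w) (snd w)) \<in> borel_measurable (borel \<Otimes>\<^sub>M borel)"
proof -
  interpret prob_space P using assms by (simp add: borel_laws_def)
  have [measurable_cong]: "sets P = sets (borel \<Otimes>\<^sub>M borel)"
    using assms by (simp add: borel_laws_def borel_prod[symmetric])
  show ?thesis unfolding joint_charfun_def by measurable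
qed

lemma norm_charfun_le_1: "prob_space P \<Longrightarrow> cmod (charfun P w) \<le> 1"
  unfolding charfun_def
  by (rule order.trans[OF integral_norm_bound]) (simp add: prob_space.prob_space)

lemma norm_joint_charfun_le_1: "prob_space P \<Longrightarrow> cmod (joint_charfun P v w) \<le> 1"
  unfolding joint_charfun_def
  by (rule order.trans[OF integral_norm_bound])
    (simp add: prob_space.prob_space norm_exp_eq_Re flip: distrib_left of_real_add)

text \<open>
  Restricting the integral to \<open>A \<times> A\<close> leaves the integrand \<open>1\<close> on a set of mass at least
  \<open>(1 / 2)\<^sup>2\<close>. Measurability and boundedness of the integrand have to be checked, since a Bochner
  integral of a non-integrable function would be \<open>0\<close>.
\<close>

lemma dependence_ge_quarter:
  fixes P :: "('a::{real_inner, second_countable_topology} \<times> 'a) measure"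
  assumes P: "P \<in> borel_laws" and \<nu>: "\<nu> \<in> borel_laws" and mass: "measure \<nu> A \<ge> 1 / 2" and A: "closed A"
    and one: "\<And>v w. v \<in> A \<Longrightarrow> w \<in> A \<Longrightarrow>
      cmod (joint_charfun P v w - charfun (distr P borel fst) v * charfun (distr P borel snd) w) = 1"
  shows "dependence \<nu> P \<ge> 1 / 4"
proof -
  interpret P: prob_space P using P by (simp add: borel_laws_def)
  interpret \<nu>: prob_space \<nu> using \<nu> by (simp add: borel_laws_def)
  interpret \<nu>\<nu>: pair_prob_space \<nu> \<nu> ..
  have [measurable_cong]: "sets \<nu> = sets borel" using \<nu> by (simp add: borel_laws_def)
  have sets_P: "sets P = sets (borel \<Otimes>\<^sub>M borel)"
    using P by (simp add: borel_laws_def borel_prod[symmetric])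
  have meas: "fst \<in> borel_measurable P" "snd \<in> borel_measurable P"
    by (simp_all add: measurable_cong_sets[OF sets_P refl])
  have marg: "prob_space (distr P borel fst)" "prob_space (distr P borel snd)"
    using meas by (auto intro: P.prob_space_distr)
  note [measurable] = borel_measurable_joint_charfun[OF P]
  have [measurable]: "charfun (distr P borel fst) \<in> borel_measurable borel"
    "charfun (distr P borel snd) \<in> borel_measurable borel"
    using marg by (auto intro!: borel_measurable_charfun simp: borel_laws_def)
  define F where "F w = (cmod (joint_charfun P (fst w) (snd w)
        - charfun (distr P borel fst) (fst w) * charfun (distr P borel snd) (snd w)))\<^sup>2" for w
  have F_meas: "F \<in> borel_measurable (\<nu> \<Otimes>\<^sub>M \<nu>)"
    unfolding F_def by measurable
  have "F w \<le> 2\<^sup>2" for w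
    unfolding F_def
  proof (rule power_mono)
    let ?a = "charfun (distr P borel fst) (fst w)" and ?b = "charfun (distr P borel snd) (snd w)"
    have "cmod (?a * ?b) \<le> 1 * 1"
      unfolding norm_mult using marg by (intro mult_mono norm_charfun_le_1) auto
    thus "cmod (joint_charfun P (fst w) (snd w) - ?a * ?b) \<le> 2"
      using norm_triangle_ineq4[of "joint_charfun P (fst w) (snd w)" "?a * ?b"]
        norm_joint_charfun_le_1[OF P.prob_space_axioms, of "fst w" "snd w"] by linarith
  qed simp
  hence "norm (F w) \<le> 4" for w
    by (simp add: F_def)
  hence int_F: "integrable (\<nu> \<Otimes>\<^sub>M \<nu>) F"
    using F_meas by (intro \<nu>\<nu>.P.integrable_const_bound[of _ 4]) auto
  have mA[measurable]: "A \<in> sets \<nu>" using A by simp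
  have "1 / 4 = (1 / 2) * (1 / 2 :: real)" by simp
  also have "\<dots> \<le> measure \<nu> A * measure \<nu> A"
    using mass by (intro mult_mono) auto
  also have "\<dots> = (LINT w|(\<nu> \<Otimes>\<^sub>M \<nu>). indicator (A \<times> A) w)"
    by (simp add: measure_def \<nu>.emeasure_pair_measure_Times enn2real_mult)
  also have "\<dots> \<le> (LINT w|(\<nu> \<Otimes>\<^sub>M \<nu>). F w)"
  proof (intro integral_mono int_F)
    show "integrable (\<nu> \<Otimes>\<^sub>M \<nu>) (indicator (A \<times> A) :: _ \<Rightarrow> real)"
      by (intro integrable_real_indicator) (auto simp: less_top[symmetric])
    show "indicator (A \<times> A) w \<le> F w" for w
      using one by (cases "w \<in> A \<times> A") (auto simp: F_def)
  qed
  finally show ?thesis by (simp add: dependence_def F_def)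
qed

section \<open>Alternatives given by codes\<close>

definition covariate :: "(nat \<Rightarrow> 'a::real_vector) \<Rightarrow> nat \<Rightarrow> nat \<times> bool \<Rightarrow> 'a" where
  "covariate x m j = x (fst j) + of_bool (snd j) *\<^sub>R x m"

definition response :: "(nat \<Rightarrow> 'a::real_vector) \<Rightarrow> nat \<Rightarrow> bool \<Rightarrow> 'a" where
  "response x m c = of_bool c *\<^sub>R x m"

text \<open>
  The covariate shows the bit \<^term>\<open>snd j\<close>, and the response hides it behind the secret bit of the
  label \<^term>\<open>fst j\<close>. To an observer who meets each label only once and does not know \<^term>\<open>g\<close>, the response looks
  like a fresh coin toss.
\<close>

definition code_law :: "(nat \<Rightarrow> 'a::real_inner) \<Rightarrow> nat \<Rightarrow> (nat \<Rightarrow> bool) \<Rightarrow> ('a \<times> 'a) measure" where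
  "code_law x m g = distr (measure_pmf (pmf_of_set ({..<m} \<times> UNIV))) borel
     (\<lambda>j. (covariate x m j, response x m (snd j \<noteq> g (fst j))))"

definition independent_law :: "(nat \<Rightarrow> 'a::real_inner) \<Rightarrow> nat \<Rightarrow> ('a \<times> 'a) measure" where
  "independent_law x m = distr (measure_pmf (pair_pmf (pmf_of_set ({..<m} \<times> UNIV)) (pmf_of_set UNIV))) borel
     (map_prod (covariate x m) (response x m))"

text \<open>
  The frequency that decodes the masked bit: the multiples of \<open>\<pi>\<close> turn addition of bits into
  multiplication of signs.
\<close>

definition direction :: "(nat \<Rightarrow> 'a::real_vector) \<Rightarrow> nat \<Rightarrow> (nat \<Rightarrow> bool) \<Rightarrow> 'a" where
  "direction x m g = pi *\<^sub>R ((\<Sum>i<m. of_bool (g i) *\<^sub>R x i) + x m)"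

lemma iexp_inner_direction:
  fixes x :: "nat \<Rightarrow> 'a::real_inner"
  assumes x: "\<And>i j. i \<le> m \<Longrightarrow> j \<le> m \<Longrightarrow> x i \<bullet> x j = of_bool (i = j)"
    and w: "w \<in> {direction x m g, - direction x m g}"
  shows "i < m \<Longrightarrow> iexp (covariate x m (i, b) \<bullet> w) = (if b \<noteq> g i then - 1 else 1)"
    and "iexp (response x m c \<bullet> w) = (if c then - 1 else 1)"
proof -
  have sign: "iexp (u \<bullet> w) = (- 1) ^ k" if u: "u \<bullet> direction x m g = pi * real k" for u k
  proof -
    have "iexp (pi * real k) = exp (of_nat k * (\<i> * complex_of_real pi))"
      by (simp add: mult_ac)
    also have "\<dots> = (- 1) ^ k"
      by (simp only: exp_of_nat_mult) (simp flip: cis_conv_exp)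
    finally have plus: "iexp (pi * real k) = (- 1) ^ k" .
    have "iexp (- (pi * real k)) = inverse (iexp (pi * real k))"
      by (simp flip: exp_minus)
    also have "\<dots> = (- 1) ^ k"
      unfolding plus by (simp flip: power_inverse)
    finally show ?thesis
      using w u plus by auto
  qed
  have x_dir: "x j \<bullet> direction x m g = (if j = m then pi else pi * of_bool (g j))" if "j \<le> m" for j
  proof -
    have "(\<Sum>i<m. of_bool (g i) * (x j \<bullet> x i)) = (\<Sum>i<m. if i = j then of_bool (g i) else 0 :: real)"
      using that by (intro sum.cong) (auto simp: x)
    thus ?thesis
      using that by (auto simp: direction_def inner_add_right inner_sum_right x)
  qed
  have "response x m c \<bullet> direction x m g = pi * real (of_bool c)"
    by (simp add: response_def x_dir)
  from sign[OF this] show "iexp (response x m c \<bullet> w) = (if c then - 1 else 1)"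
    by (cases c) simp_all
  assume "i < m"
  hence "covariate x m (i, b) \<bullet> direction x m g = pi * real (of_bool (g i) + of_bool b)"
    by (simp add: covariate_def inner_add_left x_dir distrib_left)
  from sign[OF this] show "iexp (covariate x m (i, b) \<bullet> w) = (if b \<noteq> g i then - 1 else 1)"
    by (cases b; cases "g i") simp_all
qed

lemma expectation_pmf_of_set:
  fixes f :: "'i \<Rightarrow> complex"
  assumes "finite S" "S \<noteq> {}"
  shows "(CLINT j|measure_pmf (pmf_of_set S). f j) = (\<Sum>j\<in>S. f j) / of_nat (card S)"
  using assms by (subst integral_measure_pmf[of S])
    (auto simp: scaleR_conv_of_real sum_divide_distrib)

text \<open>
  At these frequencies the covariate and the response contribute equal signs, whose product is \<open>1\<close>.
  The sign of the covariate alone averages to \<open>0\<close> because for each label it takes both values as the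
  visible bit varies; hence the product of the marginal characteristic functions vanishes.
\<close>

lemma code_law_charfun_difference:
  fixes x :: "nat \<Rightarrow> 'a::{real_inner, second_countable_topology}"
  assumes x: "\<And>i j. i \<le> m \<Longrightarrow> j \<le> m \<Longrightarrow> x i \<bullet> x j = of_bool (i = j)" and m: "m > 0"
    and v: "v \<in> {direction x m g, - direction x m g}" and w: "w \<in> {direction x m g, - direction x m g}"
  defines "P \<equiv> code_law x m g"
  shows "cmod (joint_charfun P v w - charfun (distr P borel fst) v * charfun (distr P borel snd) w) = 1"
proof -
  let ?S = "{..<m} \<times> (UNIV :: bool set)"
  let ?h = "\<lambda>j. (covariate x m j, response x m (snd j \<noteq> g (fst j)))"
  have S: "finite ?S" "?S \<noteq> {}" using m by auto
  have fst_meas: "fst \<in> borel_measurable (borel :: ('a \<times> 'a) measure)"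
    by (simp add: borel_prod[symmetric])
  have joint_meas: "(\<lambda>z. exp (\<i> * of_real (fst z \<bullet> v) + \<i> * of_real (snd z \<bullet> w))) \<in>
      borel_measurable (borel :: ('a \<times> 'a) measure)"
    unfolding borel_prod[symmetric] by measurable
  have "joint_charfun P v w = (CLINT j|measure_pmf (pmf_of_set ?S).
      iexp (covariate x m j \<bullet> v) * iexp (response x m (snd j \<noteq> g (fst j)) \<bullet> w))"
    unfolding joint_charfun_def P_def code_law_def
    by (subst integral_distr[OF _ joint_meas]) (simp_all add: exp_add)
  also have "\<dots> = (\<Sum>j\<in>?S. iexp (covariate x m j \<bullet> v) * iexp (response x m (snd j \<noteq> g (fst j)) \<bullet> w)) / of_nat (card ?S)"
    by (rule expectation_pmf_of_set[OF S])
  also have "(\<Sum>j\<in>?S. iexp (covariate x m j \<bullet> v) * iexp (response x m (snd j \<noteq> g (fst j)) \<bullet> w)) = (\<Sum>j\<in>?S. 1)"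
  proof (rule sum.cong[OF refl])
    fix j assume "j \<in> ?S"
    then obtain i b where j: "j = (i, b)" "i < m" by auto
    show "iexp (covariate x m j \<bullet> v) * iexp (response x m (snd j \<noteq> g (fst j)) \<bullet> w) = 1"
      using iexp_inner_direction(1)[OF x v j(2), of b] iexp_inner_direction(2)[OF x w, of "b \<noteq> g i"]
      unfolding j(1) fst_conv snd_conv by simp
  qed
  also have "\<dots> / of_nat (card ?S) = (1 :: complex)"
    using m by simp
  finally have joint: "joint_charfun P v w = 1" .
  have "distr P borel fst = distr (measure_pmf (pmf_of_set ?S)) borel (covariate x m)"
    unfolding P_def code_law_def by (simp add: distr_distr[OF fst_meas] comp_def)
  hence "charfun (distr P borel fst) v = (CLINT j|measure_pmf (pmf_of_set ?S). iexp (covariate x m j \<bullet> v))"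
    unfolding charfun_def by (simp add: integral_distr)
  also have "\<dots> = (\<Sum>j\<in>?S. iexp (covariate x m j \<bullet> v)) / of_nat (card ?S)"
    by (rule expectation_pmf_of_set[OF S])
  also have "(\<Sum>j\<in>?S. iexp (covariate x m j \<bullet> v)) = (\<Sum>i<m. \<Sum>b\<in>UNIV. iexp (covariate x m (i, b) \<bullet> v))"
    by (simp only: sum.cartesian_product split_def prod.collapse)
  also have "\<dots> = (\<Sum>i<m. \<Sum>b\<in>UNIV. if b \<noteq> g i then - 1 else 1)"
    by (intro sum.cong refl iexp_inner_direction(1)[OF x v]) auto
  also have "\<dots> = 0"
    by (rule sum.neutral, rule ballI) (auto simp: UNIV_bool)
  finally have "charfun (distr P borel fst) v = 0" by simp
  with joint show ?thesis by simp
qed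

lemma code_law_in_alternatives:
  fixes x :: "nat \<Rightarrow> 'a::{real_inner, second_countable_topology}"
  assumes x: "\<And>i j. i \<le> m \<Longrightarrow> j \<le> m \<Longrightarrow> x i \<bullet> x j = of_bool (i = j)" and m: "m > 0"
  shows "\<exists>\<nu>\<in>weight_measures. code_law x m g \<in> alternatives \<nu> (1 / 4)"
proof -
  let ?A = "{direction x m g, - direction x m g}"
  obtain \<nu> where \<nu>: "\<nu> \<in> weight_measures" "measure \<nu> ?A \<ge> 1 / 2"
    using weight_with_atoms by blast
  have law: "code_law x m g \<in> borel_laws"
    unfolding code_law_def by (rule borel_laws_distr_pmf)
  have "dependence \<nu> (code_law x m g) \<ge> 1 / 4"
    using \<nu> by (intro dependence_ge_quarter[of _ _ ?A] law code_law_charfun_difference[OF x m])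
      (auto simp: weight_measures_def)
  with \<nu> law show ?thesis
    by (auto simp: alternatives_def)
qed

section \<open>Averaging over all codes\<close>

text \<open>
  The prescribed values determine a code at the \<open>n\<close> distinct labels and leave it free at the other
  \<open>m - n\<close>. The factor \<open>2 ^ n\<close> stands on the left to avoid a truncated difference in the exponent.
\<close>

lemma card_prescribed_on_image:
  assumes "\<And>k. k < n \<Longrightarrow> i k < m" and inj: "inj_on i {..<n}"
  shows "card {g \<in> {..<m} \<rightarrow>\<^sub>E (UNIV :: bool set). \<forall>k<n. g (i k) = t k} * 2 ^ n = 2 ^ m"
proof -
  let ?I = "i ` {..<n}"
  have im: "?I \<subseteq> {..<m}" using assms(1) by auto
  define C where "C j = (if j \<in> ?I then {t (the_inv_into {..<n} i j)} else (UNIV :: bool set))" for j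
  have C: "C (i k) = {t k}" if "k < n" for k
    using that inj by (simp add: C_def the_inv_into_f_f)
  have "{g \<in> {..<m} \<rightarrow>\<^sub>E (UNIV :: bool set). \<forall>k<n. g (i k) = t k} = PiE {..<m} C"
  proof (intro equalityI subsetI)
    fix g assume g: "g \<in> {g \<in> {..<m} \<rightarrow>\<^sub>E (UNIV :: bool set). \<forall>k<n. g (i k) = t k}"
    hence "g j \<in> C j" for j
      by (cases "j \<in> ?I") (auto simp: C, auto simp: C_def)
    with g show "g \<in> PiE {..<m} C" by auto
  next
    fix g assume g: "g \<in> PiE {..<m} C"
    hence "g (i k) \<in> C (i k)" if "k < n" for k
      using assms(1)[OF that] by (auto simp: PiE_def Pi_def)
    with g show "g \<in> {g \<in> {..<m} \<rightarrow>\<^sub>E (UNIV :: bool set). \<forall>k<n. g (i k) = t k}"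
      by (auto simp: C PiE_def)
  qed
  moreover have "card (PiE {..<m} C) = (\<Prod>j<m. if j \<in> ?I then 1 else 2)"
    by (auto simp: card_PiE C_def intro!: prod.cong)
  moreover have "\<dots> = 2 ^ card ({..<m} - ?I)"
    by (simp add: prod.If_cases Diff_eq)
  moreover have "card ({..<m} - ?I) + n = m"
    using im inj card_mono[OF _ im] by (simp add: card_Diff_subset card_image)
  ultimately show ?thesis
    by (metis power_add)
qed

text \<open>
  Each of the \<open>n\<close> labels can be chosen outside the at most \<open>N\<close> labels used before. The bound \<open>N\<close> is
  kept apart from \<open>n\<close> so that the number of free labels stays fixed during the induction.
\<close>

lemma card_injective_labels_ge:
  assumes "n \<le> N" "N \<le> m"
  shows "card {z \<in> {..<n} \<rightarrow>\<^sub>E {..<m} \<times> (UNIV :: bool set). inj_on (fst \<circ> z) {..<n}} \<ge> (2 * (m - N)) ^ n"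
  using assms(1)
proof (induction n)
  case 0
  then show ?case by (simp add: PiE_empty_domain)
next
  case (Suc n)
  define G where "G n = {z \<in> {..<n} \<rightarrow>\<^sub>E {..<m} \<times> (UNIV :: bool set). inj_on (fst \<circ> z) {..<n}}" for n :: nat
  define free where "free z = ({..<m} - (fst \<circ> z) ` {..<n}) \<times> (UNIV :: bool set)" for z :: "nat \<Rightarrow> nat \<times> bool"
  have fin: "finite (G k)" for k
    by (rule finite_subset[of _ "{..<k} \<rightarrow>\<^sub>E {..<m} \<times> UNIV"])
      (auto simp: G_def intro!: finite_PiE)
  have "2 * (m - N) \<le> card (free z)" for z
  proof -
    have "card ((fst \<circ> z) ` {..<n}) \<le> N"
      using card_image_le[of "{..<n}" "fst \<circ> z"] Suc.prems by simp
    hence "m - N \<le> card ({..<m} - (fst \<circ> z) ` {..<n})"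
      using diff_card_le_card_Diff[of "(fst \<circ> z) ` {..<n}" "{..<m}"] by simp
    thus ?thesis by (simp add: free_def card_cartesian_product)
  qed
  hence "card (G n) * (2 * (m - N)) \<le> (\<Sum>z\<in>G n. card (free z))"
    using sum_bounded_below[of "G n" "2 * (m - N)" "\<lambda>z. card (free z)"] by simp
  moreover have "(2 * (m - N)) ^ n \<le> card (G n)"
    unfolding G_def using Suc.IH Suc_leD[OF Suc.prems] by blast
  ultimately have "(2 * (m - N)) ^ n * (2 * (m - N)) \<le> (\<Sum>z\<in>G n. card (free z))"
    by (meson mult_le_mono1 order.trans)
  also have "\<dots> = card (Sigma (G n) free)"
    using fin by (subst card_SigmaI) (auto simp: free_def)
  also have "\<dots> = card ((\<lambda>(z, j). z(n := j)) ` Sigma (G n) free)"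
  proof (rule card_image[symmetric], rule inj_onI, clarify)
    fix z j z' j'
    assume z: "z \<in> G n" "z' \<in> G n" and eq: "z(n := j) = z'(n := j')"
    have "z k = z' k" for k
      using z fun_cong[OF eq, of k] by (cases "k = n") (auto simp: G_def PiE_def extensional_def)
    thus "z = z' \<and> j = j'"
      using fun_cong[OF eq, of n] by auto
  qed
  also have "\<dots> \<le> card (G (Suc n))"
  proof (intro card_mono fin subsetI, clarify)
    fix z i b assume "z \<in> G n" "(i, b) \<in> free z"
    thus "z(n := (i, b)) \<in> G (Suc n)"
      by (auto simp: G_def free_def lessThan_Suc PiE_def Pi_def extensional_def inj_on_def)
  qed
  finally show ?case
    by (simp only: G_def power_Suc2)
qed

text \<open>
  Read \<open>z\<close> as the covariates of a sample, \<open>y\<close> as its response bits and \<open>T\<close> as acceptance of the null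
  hypothesis. If the labels in \<open>z\<close> are distinct, the response bits that a uniformly random code
  produces from \<open>z\<close> are uniformly distributed, exactly as under the null law. So on such samples the
  acceptance probability averaged over codes is the acceptance probability under the null law, and there it
  adds up with the rejection probability to the whole mass of these samples.
\<close>

lemma averaging_over_codes:
  fixes T :: "(nat \<Rightarrow> nat \<times> bool) \<Rightarrow> (nat \<Rightarrow> bool) \<Rightarrow> bool" and \<alpha> \<beta> :: real and n m :: nat
  defines "Z \<equiv> {..<n} \<rightarrow>\<^sub>E {..<m} \<times> (UNIV :: bool set)" and "Y \<equiv> {..<n} \<rightarrow>\<^sub>E (UNIV :: bool set)"
    and "\<G> \<equiv> {..<m} \<rightarrow>\<^sub>E (UNIV :: bool set)"
  assumes null: "real (card {(z, y) \<in> Z \<times> Y. \<not> T z y}) \<le> \<alpha> * (card Z * card Y)"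
    and alt: "\<And>g. g \<in> \<G> \<Longrightarrow>
      real (card {z \<in> Z. T z (\<lambda>k\<in>{..<n}. snd (z k) \<noteq> g (fst (z k)))}) \<le> \<beta> * card Z"
  shows "real (card {z \<in> Z. inj_on (fst \<circ> z) {..<n}}) \<le> (\<alpha> + \<beta>) * card Z"
proof -
  define code where "code g z = (\<lambda>k\<in>{..<n}. snd (z k) \<noteq> g (fst (z k)))" for g :: "nat \<Rightarrow> bool" and z :: "nat \<Rightarrow> nat \<times> bool"
  define good where "good = {z \<in> Z. inj_on (fst \<circ> z) {..<n}}"
  have fin: "finite Z" "finite Y" "finite \<G>"
    by (auto simp: Z_def Y_def \<G>_def intro!: finite_PiE)
  have card_Y: "card Y = 2 ^ n" and card_\<G>: "card \<G> = 2 ^ m"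
    by (auto simp: Y_def \<G>_def card_PiE)
  have good: "good \<subseteq> Z" "finite good"
    using fin by (auto simp: good_def)
  have equidistributed: "card {g \<in> \<G>. code g z = y} * 2 ^ n = 2 ^ m" if z: "z \<in> good" and y: "y \<in> Y" for z y
  proof -
    have "{g \<in> \<G>. code g z = y} = {g \<in> \<G>. \<forall>k<n. g ((fst \<circ> z) k) = (snd (z k) \<noteq> y k)}"
    proof -
      have "code g z = y \<longleftrightarrow> (\<forall>k<n. g ((fst \<circ> z) k) = (snd (z k) \<noteq> y k))" for g
      proof (rule iffI, rule allI, rule impI)
        fix k assume "code g z = y" "k < n"
        hence "y k = (snd (z k) \<noteq> g (fst (z k)))"
          by (auto simp: code_def)
        thus "g ((fst \<circ> z) k) = (snd (z k) \<noteq> y k)"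
          unfolding comp_apply by blast
      next
        assume *: "\<forall>k<n. g ((fst \<circ> z) k) = (snd (z k) \<noteq> y k)"
        show "code g z = y"
        proof
          fix k
          show "code g z k = y k"
          proof (cases "k < n")
            case True
            hence "g (fst (z k)) = (snd (z k) \<noteq> y k)"
              using * by simp
            hence "(snd (z k) \<noteq> g (fst (z k))) = y k"
              by blast
            with True show ?thesis by (simp add: code_def)
          next
            case False
            with PiE_arb[OF y[unfolded Y_def], of k] show ?thesis by (simp add: code_def)
          qed
        qed
      qed
      thus ?thesis by simp
    qed
    moreover have "(fst \<circ> z) k < m" if "k < n" for k
    proof -
      have "z k \<in> {..<m} \<times> UNIV"
        using z that by (auto simp: good_def Z_def)
      thus ?thesis by auto
    qed
    moreover have "inj_on (fst \<circ> z) {..<n}"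
      using z by (simp add: good_def)
    ultimately show ?thesis
      unfolding \<G>_def using card_prescribed_on_image[of n "fst \<circ> z" m "\<lambda>k. snd (z k) \<noteq> y k"] by simp
  qed
  have average: "card {g \<in> \<G>. T z (code g z)} * 2 ^ n = 2 ^ m * card {y \<in> Y. T z y}" if z: "z \<in> good" for z
  proof -
    have "{g \<in> \<G>. T z (code g z)} = (\<Union>y\<in>{y \<in> Y. T z y}. {g \<in> \<G>. code g z = y})"
      by (auto simp: code_def Y_def)
    moreover have "card (\<Union>y\<in>{y \<in> Y. T z y}. {g \<in> \<G>. code g z = y}) =
        (\<Sum>y\<in>{y \<in> Y. T z y}. card {g \<in> \<G>. code g z = y})"
      using fin by (intro card_UN_disjoint) auto
    ultimately have "card {g \<in> \<G>. T z (code g z)} = (\<Sum>y\<in>{y \<in> Y. T z y}. card {g \<in> \<G>. code g z = y})"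
      by simp
    hence "card {g \<in> \<G>. T z (code g z)} * 2 ^ n = (\<Sum>y\<in>{y \<in> Y. T z y}. card {g \<in> \<G>. code g z = y} * 2 ^ n)"
      by (simp only: sum_distrib_right)
    also have "\<dots> = (\<Sum>y\<in>{y \<in> Y. T z y}. 2 ^ m)"
      by (rule sum.cong) (use equidistributed[OF z] in auto)
    finally show ?thesis by simp
  qed
  \<comment> \<open>double counting of the pairs of a code and a sample that it leads to accept\<close>
  have swap: "(\<Sum>z\<in>good. card {g \<in> \<G>. T z (code g z)}) = (\<Sum>g\<in>\<G>. card {z \<in> good. T z (code g z)})"
    using sum.swap_restrict[OF good(2) fin(3), of "\<lambda>_ _. 1::nat" "\<lambda>z g. T z (code g z)"] by simp
  have "2 ^ m * (\<Sum>z\<in>good. card {y \<in> Y. T z y}) = (\<Sum>g\<in>\<G>. card {z \<in> good. T z (code g z)}) * 2 ^ n"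
    unfolding swap[symmetric] sum_distrib_left sum_distrib_right by (simp add: average)
  from arg_cong[OF this, of real]
  have "2 ^ m * real (\<Sum>z\<in>good. card {y \<in> Y. T z y}) = (\<Sum>g\<in>\<G>. real (card {z \<in> good. T z (code g z)})) * 2 ^ n"
    by (simp only: of_nat_mult of_nat_power of_nat_numeral of_nat_sum)
  also have "\<dots> \<le> (\<Sum>g\<in>\<G>. \<beta> * card Z) * 2 ^ n"
  proof (intro mult_right_mono sum_mono)
    fix g assume "g \<in> \<G>"
    have "card {z \<in> good. T z (code g z)} \<le> card {z \<in> Z. T z (code g z)}"
      using good fin by (intro card_mono) auto
    with alt[OF \<open>g \<in> \<G>\<close>] show "real (card {z \<in> good. T z (code g z)}) \<le> \<beta> * card Z"
      unfolding code_def by linarith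
  qed auto
  also have "\<dots> = 2 ^ m * (\<beta> * card Z * 2 ^ n)"
    by (simp add: card_\<G>)
  finally have accept: "real (\<Sum>z\<in>good. card {y \<in> Y. T z y}) \<le> \<beta> * card Z * 2 ^ n"
    by simp
  have "(\<Sum>z\<in>good. card {y \<in> Y. \<not> T z y}) \<le> (\<Sum>z\<in>Z. card {y \<in> Y. \<not> T z y})"
    using good fin by (intro sum_mono2) auto
  also have "\<dots> = card {(z, y) \<in> Z \<times> Y. \<not> T z y}"
  proof -
    have "{(z, y) \<in> Z \<times> Y. \<not> T z y} = Sigma Z (\<lambda>z. {y \<in> Y. \<not> T z y})"
      by auto
    thus ?thesis using fin by simp
  qed
  finally have "real (\<Sum>z\<in>good. card {y \<in> Y. \<not> T z y}) \<le> real (card {(z, y) \<in> Z \<times> Y. \<not> T z y})"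
    by (rule of_nat_mono)
  also have "\<dots> \<le> \<alpha> * card Z * 2 ^ n"
    using null unfolding card_Y by (simp add: mult.assoc)
  finally have reject: "real (\<Sum>z\<in>good. card {y \<in> Y. \<not> T z y}) \<le> \<alpha> * card Z * 2 ^ n" .
  have "card {y \<in> Y. T z y} + card {y \<in> Y. \<not> T z y} = 2 ^ n" for z
  proof -
    have "card {y \<in> Y. T z y} + card {y \<in> Y. \<not> T z y} = card ({y \<in> Y. T z y} \<union> {y \<in> Y. \<not> T z y})"
      using fin by (intro card_Un_disjoint[symmetric]) auto
    also have "{y \<in> Y. T z y} \<union> {y \<in> Y. \<not> T z y} = Y"
      by blast
    finally show ?thesis by (simp only: card_Y)
  qed
  hence "(\<Sum>z\<in>good. card {y \<in> Y. T z y}) + (\<Sum>z\<in>good. card {y \<in> Y. \<not> T z y}) = card good * 2 ^ n"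
    by (simp flip: sum.distrib)
  from arg_cong[OF this, of real]
  have "real (card good) * 2 ^ n = real (\<Sum>z\<in>good. card {y \<in> Y. T z y}) + real (\<Sum>z\<in>good. card {y \<in> Y. \<not> T z y})"
    by (simp only: of_nat_add of_nat_mult of_nat_power of_nat_numeral)
  also have "\<dots> \<le> ((\<alpha> + \<beta>) * card Z) * 2 ^ n"
    using accept reject by (simp add: algebra_simps)
  finally show ?thesis by (simp add: good_def)
qed

section \<open>The lower bound\<close>

lemma error_sum_lower_bound:
  fixes x :: "nat \<Rightarrow> 'a::{real_inner, second_countable_topology}" and \<alpha> \<beta> :: real
  assumes \<psi>: "\<psi> \<in> tests n" and n: "n \<le> m" and m: "m > 0" and nonneg: "0 \<le> \<alpha>" "0 \<le> \<beta>"
    and null: "test_prob n (independent_law x m) \<psi> 1 \<le> ennreal \<alpha>"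
    and alt: "\<And>g. test_prob n (code_law x m g) \<psi> 0 \<le> ennreal \<beta>"
  shows "1 - real n * real n / real m \<le> \<alpha> + \<beta>"
proof -
  let ?S = "{..<m} \<times> (UNIV :: bool set)"
  define Z where "Z = {..<n} \<rightarrow>\<^sub>E ?S"
  define Y where "Y = {..<n} \<rightarrow>\<^sub>E (UNIV :: bool set)"
  define sample where "sample z y = (\<lambda>k\<in>{..<n}. (covariate x m (z k), response x m (y k)))" for z :: "nat \<Rightarrow> nat \<times> bool" and y :: "nat \<Rightarrow> bool"
  define T where "T z y \<longleftrightarrow> \<psi> (sample z y) = 0" for z y
  have S: "finite ?S" "?S \<noteq> {}" and SY: "finite (?S \<times> (UNIV :: bool set))" "?S \<times> (UNIV :: bool set) \<noteq> {}"
    using m by auto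
  have card_Z: "card Z = card ?S ^ n" and card_Y: "card Y = 2 ^ n"
    by (auto simp: Z_def Y_def card_PiE)
  have card_S: "card ?S = 2 * m" by simp
  have zero_one: "\<psi> (sample z y) \<in> {0, 1}" for z y
  proof -
    have "sample z y \<in> space (\<Pi>\<^sub>M i\<in>{..<n}. (borel :: ('a \<times> 'a) measure))"
      by (simp add: sample_def space_PiM)
    with \<psi> show ?thesis
      unfolding tests_def by (auto dest: measurable_space)
  qed
  have "real (card {z \<in> Z. inj_on (fst \<circ> z) {..<n}}) \<le> (\<alpha> + \<beta>) * card Z"
    unfolding Z_def
  proof (rule averaging_over_codes[where T = T], unfold Z_def[symmetric] Y_def[symmetric])
    let ?V = "{v \<in> {..<n} \<rightarrow>\<^sub>E ?S \<times> (UNIV :: bool set).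
        \<psi> (\<lambda>k\<in>{..<n}. map_prod (covariate x m) (response x m) (v k)) = 1}"
    have "pair_pmf (pmf_of_set ?S) (pmf_of_set (UNIV :: bool set)) = pmf_of_set (?S \<times> UNIV)"
      using S by (intro pair_pmf_of_set) auto
    hence "ennreal (real (card ?V) / real (card (?S \<times> (UNIV :: bool set))) ^ n) \<le> ennreal \<alpha>"
      using null test_prob_pmf[OF \<psi> SY, of "map_prod (covariate x m) (response x m)" 1]
      by (simp only: independent_law_def)
    hence "real (card ?V) / real (card (?S \<times> (UNIV :: bool set))) ^ n \<le> \<alpha>"
      using nonneg by (simp only: ennreal_le_iff)
    moreover have "real (card (?S \<times> (UNIV :: bool set))) ^ n = real (card Z * card Y)"
      unfolding card_Z card_Y card_cartesian_product[of ?S "UNIV :: bool set"] card_UNIV_bool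
      by (simp only: of_nat_mult of_nat_power of_nat_numeral power_mult_distrib)
    moreover have "real (card Z * card Y) > 0"
      using m by (simp add: card_Z card_Y)
    ultimately have V: "real (card ?V) \<le> \<alpha> * (card Z * card Y)"
      by (simp add: pos_divide_le_eq)
    have "card {(z, y) \<in> Z \<times> Y. \<not> T z y} \<le> card ?V"
    \<comment> \<open>a sample of triples is the same as a sample of covariates with a sample of responses\<close>
    proof (rule card_inj_on_le[where f = "\<lambda>(z, y). \<lambda>k\<in>{..<n}. (z k, y k)"])
      show "inj_on (\<lambda>(z, y). \<lambda>k\<in>{..<n}. (z k, y k)) {(z, y) \<in> Z \<times> Y. \<not> T z y}"
      proof (rule inj_onI, clarify)
        fix z y z' y' assume zy: "z \<in> Z" "y \<in> Y" "z' \<in> Z" "y' \<in> Y"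
          and eq: "(\<lambda>k\<in>{..<n}. (z k, y k)) = (\<lambda>k\<in>{..<n}. (z' k, y' k))"
        have "z k = z' k \<and> y k = y' k" if "k \<in> {..<n}" for k
          using fun_cong[OF eq, of k] that by simp
        thus "z = z' \<and> y = y'"
          using PiE_ext[OF zy(1)[unfolded Z_def] zy(3)[unfolded Z_def]]
            PiE_ext[OF zy(2)[unfolded Y_def] zy(4)[unfolded Y_def]] by simp
      qed
      show "(\<lambda>(z, y). \<lambda>k\<in>{..<n}. (z k, y k)) ` {(z, y) \<in> Z \<times> Y. \<not> T z y} \<subseteq> ?V"
      proof (rule subsetI)
        fix v assume "v \<in> (\<lambda>(z, y). \<lambda>k\<in>{..<n}. (z k, y k)) ` {(z, y) \<in> Z \<times> Y. \<not> T z y}"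
        then obtain z y where zy: "z \<in> Z" and "\<not> T z y" and v: "v = (\<lambda>k\<in>{..<n}. (z k, y k))"
          by auto
        hence "\<psi> (sample z y) = 1"
          using zero_one[of z y] by (simp add: T_def)
        moreover have "(\<lambda>k\<in>{..<n}. map_prod (covariate x m) (response x m) ((\<lambda>k\<in>{..<n}. (z k, y k)) k)) = sample z y"
          by (simp add: sample_def cong: restrict_cong)
        moreover have "(\<lambda>k\<in>{..<n}. (z k, y k)) \<in> {..<n} \<rightarrow>\<^sub>E ?S \<times> UNIV"
          using zy unfolding Z_def by (auto simp: PiE_iff)
        ultimately show "v \<in> ?V"
          unfolding v by simp
      qed
      show "finite ?V"
        using SY by (intro finite_subset[OF _ finite_PiE[of "{..<n}" "\<lambda>_. ?S \<times> UNIV"]]) auto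
    qed
    with V show "real (card {(z, y) \<in> Z \<times> Y. \<not> T z y}) \<le> \<alpha> * real (card Z * card Y)"
      by linarith
  next
    fix g :: "nat \<Rightarrow> bool"
    have "{z \<in> Z. T z (\<lambda>k\<in>{..<n}. snd (z k) \<noteq> g (fst (z k)))} =
        {z \<in> Z. \<psi> (\<lambda>k\<in>{..<n}. (covariate x m (z k), response x m (snd (z k) \<noteq> g (fst (z k))))) = 0}"
      by (simp add: T_def sample_def cong: restrict_cong)
    moreover have "ennreal (real (card {z \<in> Z. \<psi> (\<lambda>k\<in>{..<n}. (covariate x m (z k), response x m (snd (z k) \<noteq> g (fst (z k))))) = 0})
        / real (card ?S) ^ n) \<le> ennreal \<beta>"
      using alt[of g] test_prob_pmf[OF \<psi> S, of "\<lambda>j. (covariate x m j, response x m (snd j \<noteq> g (fst j)))" 0]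
      by (simp only: code_law_def Z_def)
    moreover have "real (card ?S) ^ n = card Z" "real (card Z) > 0"
      using m by (simp_all add: card_Z)
    ultimately show "real (card {z \<in> Z. T z (\<lambda>k\<in>{..<n}. snd (z k) \<noteq> g (fst (z k)))}) \<le> \<beta> * real (card Z)"
      using nonneg by (simp only: ennreal_le_iff pos_divide_le_eq)
  qed
  moreover have "(2 * (real m - real n)) ^ n \<le> real (card {z \<in> Z. inj_on (fst \<circ> z) {..<n}})"
    using of_nat_mono[OF card_injective_labels_ge[OF order.refl n], where ?'a = real] n
    unfolding Z_def by (simp only: of_nat_power of_nat_mult of_nat_numeral of_nat_diff)
  ultimately have "(2 * (real m - real n)) ^ n \<le> (\<alpha> + \<beta>) * (2 * real m) ^ n"
    unfolding card_Z card_S of_nat_power of_nat_mult of_nat_numeral by linarith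
  hence "((2 * (real m - real n)) / (2 * real m)) ^ n \<le> \<alpha> + \<beta>"
    using m by (simp add: power_divide pos_divide_le_eq)
  moreover have "(2 * (real m - real n)) / (2 * real m) = 1 + (- (real n / real m))"
    using m by (simp add: field_simps)
  moreover have "1 + real n * (- (real n / real m)) \<le> (1 + (- (real n / real m))) ^ n"
    using m n by (intro Bernoulli_inequality) simp
  ultimately show ?thesis by simp
qed

theorem theorem4p5:
  fixes \<alpha> \<beta> :: real
  assumes infinite_dim: "\<nexists>B :: 'a::{real_inner, banach, second_countable_topology} set. finite B \<and> span B = UNIV"
    and "0 < \<alpha>" "\<alpha> < 1" "0 < \<beta>" "\<beta> < 1" "\<alpha> + \<beta> < 1"
  shows "\<exists>c>0. \<forall>\<^sub>F n in sequentially.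
           ennreal (c * real n powr (- 1 / 2)) \<le> minimax_rate TYPE('a) n \<alpha> \<beta>"
proof (intro exI conjI always_eventually allI)
  show "(0 :: real) < 1 / 4" by simp
  fix n :: nat
  have quarter: "1 / 4 \<le> \<rho>"
    if \<psi>: "\<psi> \<in> (level_tests n \<alpha> :: 'a test set)"
      and power: "(SUP \<nu>\<in>weight_measures. SUP P\<in>alternatives \<nu> \<rho>. test_prob n P \<psi> 0) \<le> ennreal \<beta>" for \<psi> \<rho>
  proof (rule ccontr)
    assume "\<not> 1 / 4 \<le> \<rho>"
    \<comment> \<open>so many labels that \<open>n\<close> draws rarely collide, which is where infinite dimension enters\<close>
    define m where "m = n + Suc (nat \<lceil>real n * real n / (1 - \<alpha> - \<beta>)\<rceil>)"
    have "real n * real n / (1 - \<alpha> - \<beta>) < real m"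
      unfolding m_def by linarith
    moreover have m: "n \<le> m" "0 < m"
      by (simp_all add: m_def)
    ultimately have small: "\<alpha> + \<beta> < 1 - real n * real n / real m"
      using assms by (simp add: field_simps)
    obtain x :: "nat \<Rightarrow> 'a" where "\<forall>i<Suc m. \<forall>j<Suc m. x i \<bullet> x j = of_bool (i = j)"
      using orthonormal_sequence[OF infinite_dim] by blast
    hence x: "\<And>i j. i \<le> m \<Longrightarrow> j \<le> m \<Longrightarrow> x i \<bullet> x j = of_bool (i = j)"
      by (simp add: less_Suc_eq_le)
    have "1 - real n * real n / real m \<le> \<alpha> + \<beta>"
    proof (rule error_sum_lower_bound)
      show "\<psi> \<in> tests n" "0 \<le> \<alpha>" "0 \<le> \<beta>"
        using \<psi> assms by (simp_all add: level_tests_def)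
      have "independent_law x m \<in> null_laws"
        unfolding independent_law_def by (rule distr_pair_pmf_null_law)
      hence "test_prob n (independent_law x m) \<psi> 1 \<le> (SUP P\<in>null_laws. test_prob n P \<psi> 1)"
        by (rule SUP_upper)
      also have "\<dots> \<le> ennreal \<alpha>"
        using \<psi> by (simp add: level_tests_def)
      finally show "test_prob n (independent_law x m) \<psi> 1 \<le> ennreal \<alpha>" .
      fix g
      obtain \<nu> where \<nu>: "\<nu> \<in> weight_measures" "code_law x m g \<in> alternatives \<nu> (1 / 4)"
        using code_law_in_alternatives[OF x m(2)] by blast
      hence "code_law x m g \<in> alternatives \<nu> \<rho>"
        using \<open>\<not> 1 / 4 \<le> \<rho>\<close> by (simp add: alternatives_def)
      hence "test_prob n (code_law x m g) \<psi> 0 \<le> (SUP P\<in>alternatives \<nu> \<rho>. test_prob n P \<psi> 0)"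
        by (rule SUP_upper)
      also have "\<dots> \<le> (SUP \<nu>\<in>weight_measures. SUP P\<in>alternatives \<nu> \<rho>. test_prob n P \<psi> 0)"
        using \<nu>(1) by (rule SUP_upper)
      also note power
      finally show "test_prob n (code_law x m g) \<psi> 0 \<le> ennreal \<beta>" .
    qed (rule m)+
    with small show False by linarith
  qed
  have "real n powr (- 1 / 2) \<le> 1"
    using powr_mono[of "- 1 / 2" 0 "real n"] by (cases "n = 0") auto
  hence "ennreal (1 / 4 * real n powr (- 1 / 2)) \<le> ennreal (1 / 4)"
    by (intro ennreal_leI) simp
  also have "\<dots> \<le> minimax_rate TYPE('a) n \<alpha> \<beta>"
    unfolding minimax_rate_def separation_rate_def
    by (intro INF_greatest ennreal_leI) (use quarter in blast)
  finally show "ennreal (1 / 4 * real n powr (- 1 / 2)) \<le> minimax_rate TYPE('a) n \<alpha> \<beta>" .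
qed

end
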